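(* For every process $i\in\mathbb{P}$ let $\varphi_i$ be an $i$-local fact in the system $R_{\mathcal P}=R(\mathcal{P},\gamma^t)$, let $\bar\varphi_c\triangleq\bigwedge_{\text{correct } i}\varphi_i$, and fix a time $m\ge 0$. Assume that the protocol $\mathcal{P}$ implements a silent confirmation round for $\bar\varphi_c$ in round $m+1$, and fix a run $r$ of $\mathcal{P}$ (i.e. $r\in R_{\mathcal P}$). Then a process $j$ that receives no messages whatsoever in round $m+1$ of $r$ knows at time $m+1$ in $r$ that $\bar\varphi_c$ was true at time $m$.
   Context: **Model $\gamma^t$.** There is a set $\mathbb{P}=\{0,\dots,n-1\}$ of $n>2$ processes, every pair connected by a reliable two-way link; receivers know the identity of the sender. Time is discrete and global, starting at $0$; round $m+1$ takes place between times $m$ and $m+1$, and a message sent at time $m$ (in round $m+1$) is received by time $m+1$. The local state $r_i(m)$ of process $i$ at time $m$ in run $r$ consists of its initial value $v_i$, the time $m$, and the sequence of its actions up to time $m$, including the messages it has sent and received. A protocol is a deterministic function from local states to messages sent and decisions. In each run a process is either correct (follows the protocol) or faulty (Byzantine: behaves arbitrarily); at most $t$ processes are faulty, where $1\le t<n$. $R(\mathcal{P},\gamma^t)$ is the set of all runs of $\mathcal{P}$ in which at most $t$ processes are faulty. **Indistinguishability and knowledge.** Runs $r,r'$ are indistinguishable to $i$ at time $m$, written $r\approx_i^m r'$, if $r_i(m)=r'_i(m)$. Process $i$ *knows* $\varphi$ at time $m$ in $r\in R$ (with respect to a system, i.e. set of runs, $R$) iff $\varphi$ is true of all runs $r'\in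 R$ with $r'\approx_i^m r$. **Local facts.** An $i$-local fact is a fact whose truth at time $m$ in a run is determined by $i$'s local state at time $m$. The fact $\bar\varphi_c$ holds at time $m$ in a run $r$ iff $\varphi_i$ holds at time $m$ in $r$ for every process $i$ that is correct in $r$. **Silent confirmation round.** $\mathcal{P}$ implements a silent confirmation round for $\bar\varphi_c$ in round $m+1$ if in every run $r\in R_{\mathcal P}$, each correct $i\in\mathbb{P}$ sends messages to everyone in round $m+1$ in case $\varphi_i$ does not hold at time $m$. ("Everyone" includes $i$ itself.) *)

theory Defs
  imports Main
begin

text \<open>
  Processes are the numbers below n. A round is indexed by the time at which it starts:
  index k stands for round k+1, which takes place between times k and k+1.
  A link carries at most one message per direction and round; its content is arbitrary.
\<close>

record ('m, 'd) round_actions =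
  msgs_out :: "nat \<Rightarrow> 'm option"  \<comment> \<open>indexed by the recipient\<close>
  msgs_in :: "nat \<Rightarrow> 'm option"  \<comment> \<open>indexed by the sender\<close>
  decided :: "'d option"

record ('v, 'm, 'd) local_state =
  initial_value :: 'v
  current_time :: nat
  history :: "('m, 'd) round_actions list"

text \<open>
  A protocol maps the local state of a process at time k to the messages it sends at time k
  (indexed by the recipient) and its decision; the first argument is the process executing it.
\<close>

type_synonym ('v, 'm, 'd) protocol =
  "nat \<Rightarrow> ('v, 'm, 'd) local_state \<Rightarrow> (nat \<Rightarrow> 'm option) \<times> 'd option"

text \<open>
  The set of faulty processes is part of the run, since a Byzantine process may happen to
  behave as the protocol prescribes.
\<close>

record ('v, 'm, 'd) run =
  inputs :: "nat \<Rightarrow> 'v"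
  faulty :: "nat set"
  sent :: "nat \<Rightarrow> nat \<Rightarrow> nat \<Rightarrow> 'm option"  \<comment> \<open>round, sender, recipient\<close>
  received :: "nat \<Rightarrow> nat \<Rightarrow> nat \<Rightarrow> 'm option"  \<comment> \<open>round, recipient, sender\<close>
  decision :: "nat \<Rightarrow> nat \<Rightarrow> 'd option"  \<comment> \<open>round, process\<close>

text \<open>
  The local state at time m covers the rounds 1 to m; the messages sent at time m belong to
  round m+1 and are determined by this state.
\<close>

definition state_at :: "('v, 'm, 'd) run \<Rightarrow> nat \<Rightarrow> nat \<Rightarrow> ('v, 'm, 'd) local_state" where
  "state_at r i m =
     \<lparr> initial_value = inputs r i,
       current_time = m,
       history = map (\<lambda>k. \<lparr> msgs_out = sent r k i,
                             msgs_in = received r k i,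
                             decided = decision r k i \<rparr>) [0..<m] \<rparr>"

definition correct :: "nat \<Rightarrow> ('v, 'm, 'd) run \<Rightarrow> nat \<Rightarrow> bool" where
  "correct n r i \<longleftrightarrow> i < n \<and> i \<notin> faulty r"

definition follows_protocol ::
  "nat \<Rightarrow> ('v, 'm, 'd) protocol \<Rightarrow> ('v, 'm, 'd) run \<Rightarrow> nat \<Rightarrow> bool" where
  "follows_protocol n P r i \<longleftrightarrow>
     (\<forall>k. (\<forall>j<n. sent r k i j = fst (P i (state_at r i k)) j) \<and>
          decision r k i = snd (P i (state_at r i k)))"

text \<open>
  Links, including the one from a process to itself, neither lose, corrupt nor forge messages,
  also when an endpoint is faulty.
\<close>

definition reliable_links :: "nat \<Rightarrow> ('v, 'm, 'd) run \<Rightarrow> bool" where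
  "reliable_links n r \<longleftrightarrow>
     (\<forall>k i j. received r k j i = sent r k i j) \<and>
     (\<forall>k i j. \<not> (i < n \<and> j < n) \<longrightarrow> sent r k i j = None)"

definition runs :: "nat \<Rightarrow> nat \<Rightarrow> ('v, 'm, 'd) protocol \<Rightarrow> ('v, 'm, 'd) run set" where
  "runs n t P =
     {r. faulty r \<subseteq> {..<n} \<and> card (faulty r) \<le> t \<and> reliable_links n r \<and>
         (\<forall>i. correct n r i \<longrightarrow> follows_protocol n P r i)}"

definition indistinguishable ::
  "nat \<Rightarrow> nat \<Rightarrow> ('v, 'm, 'd) run \<Rightarrow> ('v, 'm, 'd) run \<Rightarrow> bool" where
  "indistinguishable i m r r' \<longleftrightarrow> state_at r i m = state_at r' i m"

definition knows ::
  "('v, 'm, 'd) run set \<Rightarrow> nat \<Rightarrow> nat \<Rightarrow> ('v, 'm, 'd) run \<Rightarrow> (('v, 'm, 'd) run \<Rightarrow> bool) \<Rightarrow> bool"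
where
  "knows R i m r \<phi> \<longleftrightarrow> (\<forall>r'\<in>R. indistinguishable i m r' r \<longrightarrow> \<phi> r')"

text \<open>A time-dependent fact is a predicate on a run and a time.\<close>

type_synonym ('v, 'm, 'd) fact = "('v, 'm, 'd) run \<Rightarrow> nat \<Rightarrow> bool"

definition local_fact ::
  "('v, 'm, 'd) run set \<Rightarrow> nat \<Rightarrow> ('v, 'm, 'd) fact \<Rightarrow> bool" where
  "local_fact R i \<phi> \<longleftrightarrow>
     (\<forall>r\<in>R. \<forall>r'\<in>R. \<forall>m. indistinguishable i m r r' \<longrightarrow> \<phi> r m = \<phi> r' m)"

definition all_correct :: "nat \<Rightarrow> (nat \<Rightarrow> ('v, 'm, 'd) fact) \<Rightarrow> ('v, 'm, 'd) fact" where
  "all_correct n \<phi> r m \<longleftrightarrow> (\<forall>i. correct n r i \<longrightarrow> \<phi> i r m)"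

definition silent_confirmation_round ::
  "nat \<Rightarrow> nat \<Rightarrow> ('v, 'm, 'd) protocol \<Rightarrow> (nat \<Rightarrow> ('v, 'm, 'd) fact) \<Rightarrow> nat \<Rightarrow> bool" where
  "silent_confirmation_round n t P \<phi> m \<longleftrightarrow>
     (\<forall>r\<in>runs n t P. \<forall>i. correct n r i \<longrightarrow> \<not> \<phi> i r m \<longrightarrow> (\<forall>j<n. sent r m i j \<noteq> None))"

end

theory Submission
  imports Defs
begin

text \<open>Silence is part of what \<open>j\<close> observes: its state at time
  \<open>m + 1\<close> records round m+1, so \<open>j\<close> receives nothing in any run
  \<open>r'\<close> it cannot tell from \<open>r\<close>. A correct \<open>i\<close> of
  \<open>r'\<close> violating \<open>\<phi> i\<close> at time \<open>m\<close> would have sent to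
  everyone, hence to \<open>j\<close>, and the reliable link would have delivered that message
  within the round.\<close>

lemma indistinguishable_received:
  assumes "indistinguishable i m r r'" and "k < m"
  shows "received r k i = received r' k i"
  using assms by (simp add: indistinguishable_def state_at_def)

theorem theorem5:
  fixes n t m j :: nat
    and P :: "('v, 'm, 'd) protocol"
    and \<phi> :: "nat \<Rightarrow> ('v, 'm, 'd) fact"
    and r :: "('v, 'm, 'd) run"
  assumes "n > 2"
    and "1 \<le> t" and "t < n"
    and "\<And>i. i < n \<Longrightarrow> local_fact (runs n t P) i (\<phi> i)"
    and "silent_confirmation_round n t P \<phi> m"
    and "r \<in> runs n t P"
    and "j < n"
    and "\<forall>i<n. received r m j i = None"
  shows "knows (runs n t P) j (m + 1) r (\<lambda>r'. all_correct n \<phi> r' m)"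
  unfolding knows_def all_correct_def
proof (intro ballI impI allI)
  fix r' i
  assume r': "r' \<in> runs n t P" and ind: "indistinguishable j (m + 1) r' r"
    and i: "correct n r' i"
  \<comment> \<open>Index \<open>m\<close> denotes round m+1, the last entry of the history at time
    \<open>m + 1\<close>. As \<open>i\<close> is correct in \<open>r'\<close> but possibly faulty in
    \<open>r\<close>, the silence in \<open>r\<close> has to cover all senders.\<close>
  have "received r' m j i = None"
    using indistinguishable_received[OF ind, of m] assms(8) i by (simp add: correct_def)
  then have "sent r' m i j = None"
    using r' by (simp add: runs_def reliable_links_def)
  then show "\<phi> i r' m"
    using assms(5,7) r' i unfolding silent_confirmation_round_def by blast
qed

end
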